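(* Let $\mathfrak{A}$ be a residuated lattice. The following assertions are equivalent: (1) for any $F,G\in \Omega(\mathfrak{A})$, $F\vee^{\omega} G=A$ implies $F\veebar G=A$; (2) $\mathfrak{A}$ is normal; (3) for any $\mathcal{F}\subseteq \Omega(\mathfrak{A})$ we have $\veebar \mathcal{F}\in \Omega(\mathfrak{A})$; (4) $\Omega(\mathfrak{A})$ is a sublattice of $\mathscr{F}(\mathfrak{A})$; (5) $\gamma(\mathfrak{A})$ is a sublattice of $\mathscr{F}(\mathfrak{A})$.
   Context: A residuated lattice is an algebra $\mathfrak{A}=(A;\vee,\wedge,\odot,\rightarrow,0,1)$ such that $\ell(\mathfrak{A})=(A;\vee,\wedge,0,1)$ is a bounded lattice, $(A;\odot,1)$ is a commutative monoid, and $x\odot y\leq z$ iff $x\leq y\rightarrow z$ for all $x,y,z\in A$. A filter of $\mathfrak{A}$ is a non-empty subset $F\subseteq A$ such that $x,y\in F$ implies $x\odot y\in F$, and $x\in F$, $y\in A$ implies $x\vee y\in F$. $\mathscr{F}(\mathfrak{A})$ is the set of all filters, a complete lattice with meet $\cap$ and join $\veebar\mathcal{F}$ = the filter generated by $\bigcup\mathcal{F}$. A filter $P\neq A$ is prime if $x\vee y\in P$ implies $x\in P$ or $y\in P$; a minimal prime filter is a minimal element (under inclusion) of the set of all prime filters. $\mathfrak{A}$ is normal if every prime filter contains at most one minimal prime filter. For $x\in A$, $x^{\perp}=\{a\in A\mid x\vee a=1\}$, and $\gamma(\mathfrak{A})=\{x^{\perp}\mid x\in A\}$. An ideal of $\ell(\mathfrak{A})$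 is a non-empty subset closed under $\vee$ and downward closed; $I\curlyvee J$ is the ideal generated by $I\cup J$. For $X\subseteq A$, $\omega(X)=\{a\in A\mid x\vee a=1\text{ for some }x\in X\}$. A filter $H$ is an $\omega$-filter if $H=\omega(I)$ for some ideal $I$ of $\ell(\mathfrak{A})$; $\Omega(\mathfrak{A})$ is the set of $\omega$-filters. It is a bounded distributive lattice under inclusion with meet $\cap$ and join $G\vee^{\omega}H=\omega(I_G\curlyvee I_H)$, where $I_G,I_H$ are ideals with $G=\omega(I_G)$, $H=\omega(I_H)$. A subset of $\mathscr{F}(\mathfrak{A})$ is a sublattice of $\mathscr{F}(\mathfrak{A})$ if it is closed under $\cap$ and binary $\veebar$. *)

theory Defs
  imports Main "HOL.Hull"
begin

text \<open>
  The carrier is the whole type. The constants \<open>0\<close> and \<open>1\<close> of a residuated lattice are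
  \<open>bot\<close> and \<open>1\<close> (\<open>= top\<close>), and \<open>(*)\<close> is the monoid operation.
  The one-element algebra (\<open>bot = top\<close>) is not excluded.
\<close>

class residuated_lattice = bounded_lattice + comm_monoid_mult +
  fixes residuum :: "'a \<Rightarrow> 'a \<Rightarrow> 'a"
  assumes one_eq_top: "1 = top"
    and residuation: "x * y \<le> z \<longleftrightarrow> x \<le> residuum y z"

definition rl_filter :: "'a::residuated_lattice set \<Rightarrow> bool" where
  "rl_filter F \<longleftrightarrow> F \<noteq> {} \<and> (\<forall>x\<in>F. \<forall>y\<in>F. x * y \<in> F) \<and> (\<forall>x\<in>F. \<forall>y. sup x y \<in> F)"

definition filter_join :: "'a::residuated_lattice set set \<Rightarrow> 'a set" where
  "filter_join \<F> = rl_filter hull (\<Union>\<F>)"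

definition prime_filter :: "'a::residuated_lattice set \<Rightarrow> bool" where
  "prime_filter P \<longleftrightarrow> rl_filter P \<and> P \<noteq> UNIV \<and> (\<forall>x y. sup x y \<in> P \<longrightarrow> x \<in> P \<or> y \<in> P)"

definition minimal_prime_filter :: "'a::residuated_lattice set \<Rightarrow> bool" where
  "minimal_prime_filter M \<longleftrightarrow> prime_filter M \<and> (\<forall>P. prime_filter P \<and> P \<subseteq> M \<longrightarrow> P = M)"

definition normal_rl :: "'a::residuated_lattice itself \<Rightarrow> bool" where
  "normal_rl _ \<longleftrightarrow> (\<forall>P M N :: 'a set. prime_filter P \<and> minimal_prime_filter M \<and> minimal_prime_filter N
      \<and> M \<subseteq> P \<and> N \<subseteq> P \<longrightarrow> M = N)"

definition coannihilator :: "'a::residuated_lattice \<Rightarrow> 'a set" where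
  "coannihilator x = {a. sup x a = 1}"

definition coannihilators :: "'a::residuated_lattice set set" where
  "coannihilators = range coannihilator"

definition lattice_ideal :: "'a::lattice set \<Rightarrow> bool" where
  "lattice_ideal I \<longleftrightarrow> I \<noteq> {} \<and> (\<forall>x\<in>I. \<forall>y\<in>I. sup x y \<in> I) \<and> (\<forall>x\<in>I. \<forall>y. y \<le> x \<longrightarrow> y \<in> I)"

definition ideal_join :: "'a::lattice set \<Rightarrow> 'a set \<Rightarrow> 'a set" where
  "ideal_join I J = lattice_ideal hull (I \<union> J)"

definition omega :: "'a::residuated_lattice set \<Rightarrow> 'a set" where
  "omega X = {a. \<exists>x\<in>X. sup x a = 1}"

definition omega_filters :: "'a::residuated_lattice set set" where
  "omega_filters = {H. rl_filter H \<and> (\<exists>I. lattice_ideal I \<and> H = omega I)}"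

text \<open>
  The join of two \<open>\<omega>\<close>-filters is given by representing ideals; by \<open>omega_join_omega\<close> below
  it does not depend on their choice, so the definite description is meaningful.
\<close>

definition omega_join :: "'a::residuated_lattice set \<Rightarrow> 'a set \<Rightarrow> 'a set" where
  "omega_join G H = (THE K. \<exists>I J. lattice_ideal I \<and> lattice_ideal J \<and> G = omega I \<and> H = omega J
      \<and> K = omega (ideal_join I J))"

definition filter_sublattice :: "'a::residuated_lattice set set \<Rightarrow> bool" where
  "filter_sublattice S \<longleftrightarrow> S \<subseteq> Collect rl_filter
      \<and> (\<forall>F\<in>S. \<forall>G\<in>S. F \<inter> G \<in> S \<and> filter_join {F, G} \<in> S)"

lemma ideal_join_eq:
  assumes "lattice_ideal I" "lattice_ideal J"
  shows "ideal_join I J = {a. \<exists>i\<in>I. \<exists>j\<in>J. a \<le> sup i j}" (is "_ = ?K")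
  unfolding ideal_join_def
proof (rule hull_unique)
  obtain i j where "i \<in> I" "j \<in> J"
    using assms unfolding lattice_ideal_def by (metis ex_in_conv)
  then have "?K \<noteq> {}" by blast
  moreover have "sup x y \<in> ?K" if xy: "x \<in> ?K" "y \<in> ?K" for x y
  proof -
    obtain i j i' j' where *: "i \<in> I" "j \<in> J" "x \<le> sup i j" "i' \<in> I" "j' \<in> J" "y \<le> sup i' j'"
      using xy by blast
    then have "sup i i' \<in> I" "sup j j' \<in> J"
      using assms unfolding lattice_ideal_def by blast+
    moreover have "sup x y \<le> sup (sup i i') (sup j j')"
      using sup_mono[OF *(3,6)] by (simp add: ac_simps)
    ultimately show ?thesis by blast
  qed
  ultimately show "lattice_ideal ?K"
    unfolding lattice_ideal_def by (blast intro: order_trans)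
  show "I \<union> J \<subseteq> ?K"
    using \<open>i \<in> I\<close> \<open>j \<in> J\<close> by (blast intro: sup_ge1 sup_ge2)
  show "?K \<subseteq> T" if "I \<union> J \<subseteq> T" "lattice_ideal T" for T
    using that unfolding lattice_ideal_def by blast
qed

lemma omega_ideal_join:
  assumes "lattice_ideal I" "lattice_ideal J"
  shows "omega (ideal_join I J) = {a. \<exists>i\<in>I. \<exists>j\<in>J. sup (sup i j) a = 1}"
proof -
  have "sup x a = top \<Longrightarrow> x \<le> y \<Longrightarrow> sup y a = top" for x y a :: 'a
    by (metis sup.absorb1 sup_assoc sup_commute sup_top_left)
  then show ?thesis
    unfolding omega_def ideal_join_eq[OF assms] one_eq_top by blast
qed

lemma omega_join_omega:
  assumes "lattice_ideal I" "lattice_ideal J"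
  shows "omega_join (omega I) (omega J) = omega (ideal_join I J)"
proof -
  define R where "R I J = {a::'a. \<exists>i\<in>I. \<exists>j\<in>J. sup (sup i j) a = 1}" for I J
  have left: "R I J = {a. \<exists>j\<in>J. sup j a \<in> omega I}" for I J
    unfolding R_def omega_def by (simp only: mem_Collect_eq sup.assoc) blast
  have eq: "sup j (sup i a) = sup (sup i j) a" for i j a :: 'a
    by (simp add: ac_simps)
  have right: "R I J = {a. \<exists>i\<in>I. sup i a \<in> omega J}" for I J
    unfolding R_def omega_def by (simp only: mem_Collect_eq eq)
  have "omega (ideal_join I' J') = omega (ideal_join I J)"
    if rep: "lattice_ideal I'" "lattice_ideal J'" "omega I = omega I'" "omega J = omega J'" for I' J'
  proof -
    have "R I J = R I' J"
      by (simp only: left rep(3))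
    also have "\<dots> = R I' J'"
      by (simp only: right rep(4))
    finally show ?thesis
      unfolding omega_ideal_join[OF assms] omega_ideal_join[OF rep(1,2)] R_def by (rule sym)
  qed
  then show ?thesis
    unfolding omega_join_def using assms by (intro the_equality) blast+
qed

end

theory Submission imports Defs begin

text \<open>
  Normality and the four assertions on filters are each shown equivalent to one elementary
  condition, called comaximality below: whenever \<open>x \<squnion> y = 1\<close>, the coannihilators of \<open>x\<close> and \<open>y\<close>
  together generate the improper filter. When \<open>x \<squnion> y = 1\<close>, each of \<open>x\<close> and \<open>y\<close> is called a
  join-complement of the other.

  The lattice-theoretic assertions meet this condition as follows. A coannihilator is the
  \<open>\<omega>\<close>-filter of a principal ideal, and if \<open>x \<squnion> y = 1\<close> then the \<open>\<omega>\<close>-join of the two coannihilators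
  is everything; so the assertion about \<open>\<omega>\<close>-joins specialises to comaximality. Likewise, an
  \<open>\<omega>\<close>-filter that contains both of these coannihilators must be everything
  (\<open>omega_filter_above_comaximal_pair\<close>), so each of the three closure assertions forces
  comaximality already through the join of two coannihilators. Conversely, comaximality yields
  \<open>(x \<squnion> y)\<^sup>\<bottom> \<subseteq> x\<^sup>\<bottom> \<or> y\<^sup>\<bottom>\<close>, the join being that of filters. Hence for every filter \<open>K\<close> the elements
  whose coannihilator lies in \<open>K\<close> form an ideal, and when \<open>K\<close> is a join of \<open>\<omega>\<close>-filters this
  ideal represents \<open>K\<close>. Closure under intersection holds in every residuated lattice: a
  common join-complement of \<open>x\<close> and \<open>y\<close> is a join-complement of \<open>x * y\<close>.

  For normality, the tool is a separation theorem: a nonempty join-closed set avoiding \<open>1\<close>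
  misses some prime filter. It gives the usual description of minimality (each \<open>x\<close> in a minimal prime \<open>M\<close>
  satisfies \<open>x \<squnion> y = 1\<close> for some \<open>y \<notin> M\<close>), and it shows that a prime filter \<open>P\<close> containing
  \<open>x\<^sup>\<bottom>\<close> lies above a minimal prime omitting \<open>x\<close>. If comaximality fails at \<open>x \<squnion> y = 1\<close>, a prime
  filter above both coannihilators therefore has two minimal primes below it, one omitting \<open>x\<close>
  and one omitting \<open>y\<close>; they differ, since a prime filter cannot omit both. If
  comaximality holds, take distinct minimal primes \<open>M\<close> and \<open>N\<close>: for some \<open>x\<close> and \<open>y\<close> with join \<open>1\<close>,
  one of them contains \<open>x\<^sup>\<bottom>\<close> and the other \<open>y\<^sup>\<bottom>\<close>, so no proper filter lies above both.

  The underlying lattice need not be distributive. What replaces distributivity is the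
  inequality \<open>(x \<squnion> z) * (y \<squnion> z) \<le> x * y \<squnion> z\<close>, which makes \<open>{a. a \<squnion> b \<in> F}\<close> a filter for every
  filter \<open>F\<close>. Using these filters avoids any explicit description of generated filters.
\<close>

section \<open>Arithmetic of residuated lattices\<close>

lemma le_one [simp]: "x \<le> (1 :: 'a::residuated_lattice)"
  by (simp add: one_eq_top)

lemma sup_eq_one_mono:
  fixes x y a :: "'a::residuated_lattice"
  assumes "sup x a = 1" "x \<le> y"
  shows "sup y a = 1"
  using assms by (metis le_one order.antisym order_refl sup_mono)

lemma mult_right_mono_rl:
  fixes x y z :: "'a::residuated_lattice"
  assumes "x \<le> y"
  shows "x * z \<le> y * z"
  using assms order_trans residuation by blast

lemma mult_le_left: "x * y \<le> (x :: 'a::residuated_lattice)"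
  using mult_right_mono_rl[of y 1 x] by (simp add: mult.commute)

lemma mult_le_right: "x * y \<le> (y :: 'a::residuated_lattice)"
  using mult_le_left[of y x] by (simp add: mult.commute)

lemma sup_mult_distrib:
  fixes x y z :: "'a::residuated_lattice"
  shows "sup x y * z = sup (x * z) (y * z)"
proof (rule order.antisym)
  have "x \<le> residuum z (sup (x * z) (y * z))" "y \<le> residuum z (sup (x * z) (y * z))"
    by (simp_all flip: residuation)
  then show "sup x y * z \<le> sup (x * z) (y * z)"
    by (simp add: residuation)
qed (simp add: mult_right_mono_rl)

text \<open>
  Three of the four products obtained by expanding the left-hand side have \<open>z\<close> as a factor.
\<close>

lemma mult_sup_le:
  fixes x y z :: "'a::residuated_lattice"
  shows "sup x z * sup y z \<le> sup (x * y) z"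
proof -
  have "x * sup y z \<le> sup (x * y) z"
    using sup_mono[OF order_refl mult_le_left, of "y * x" z x]
    by (simp add: mult.commute[of x] sup_mult_distrib)
  moreover have "z * sup y z \<le> sup (x * y) z"
    using mult_le_left le_supI2 by blast
  ultimately show ?thesis
    by (simp add: sup_mult_distrib)
qed

lemma mult_sup_eq_one:
  fixes x y z :: "'a::residuated_lattice"
  assumes "sup x z = 1" "sup y z = 1"
  shows "sup (x * y) z = 1"
  using mult_sup_le[of x z y] assms by (simp add: order.antisym)

section \<open>Filters\<close>

lemma rl_filter_up:
  assumes "rl_filter F" "x \<in> F" "x \<le> y"
  shows "y \<in> F"
  using assms unfolding rl_filter_def by (metis sup.absorb2)

lemma rl_filter_one:
  assumes "rl_filter F"
  shows "1 \<in> F"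
  using assms rl_filter_up le_one unfolding rl_filter_def by blast

lemma rl_filter_eq_UNIV_iff:
  assumes "rl_filter F"
  shows "F = UNIV \<longleftrightarrow> bot \<in> F"
  using assms rl_filter_up bot_least by blast

lemma rl_filterI:
  assumes "1 \<in> F" "\<And>x y. x \<in> F \<Longrightarrow> y \<in> F \<Longrightarrow> x * y \<in> F" "\<And>x y. x \<in> F \<Longrightarrow> x \<le> y \<Longrightarrow> y \<in> F"
  shows "rl_filter F"
  using assms unfolding rl_filter_def by (metis empty_iff sup_ge1)

lemma rl_filter_singleton_one: "rl_filter {1 :: 'a::residuated_lattice}"
  by (rule rl_filterI) (simp_all add: order.antisym)

lemma rl_filter_Inter:
  assumes "\<And>F. F \<in> \<F> \<Longrightarrow> rl_filter F"
  shows "rl_filter (\<Inter>\<F>)"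
proof -
  have "1 \<in> \<Inter>\<F>"
    using assms rl_filter_one by blast
  then show ?thesis
    using assms unfolding rl_filter_def by blast
qed

lemma rl_filter_Union_chain:
  assumes "\<C> \<noteq> {}" "subset.chain {F. rl_filter F} \<C>"
  shows "rl_filter (\<Union>\<C>)"
proof (rule rl_filterI)
  have fil: "rl_filter F" if "F \<in> \<C>" for F
    using assms(2) that unfolding subset_chain_def by blast
  show "1 \<in> \<Union>\<C>"
    using assms(1) fil rl_filter_one by blast
  show "x * y \<in> \<Union>\<C>" if "x \<in> \<Union>\<C>" "y \<in> \<Union>\<C>" for x y
  proof -
    obtain F where "F \<in> \<C>" "x \<in> F" "y \<in> F"
      using \<open>x \<in> \<Union>\<C>\<close> \<open>y \<in> \<Union>\<C>\<close> assms(2) unfolding subset_chain_def by blast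
    then show ?thesis
      using fil unfolding rl_filter_def by blast
  qed
  show "y \<in> \<Union>\<C>" if "x \<in> \<Union>\<C>" "x \<le> y" for x y
    using that fil rl_filter_up by blast
qed

text \<open>
  This is the filter quotient by the single element \<open>b\<close>. It lets a statement about \<open>a \<squnion> b\<close>
  be checked on generators: to see that \<open>a \<squnion> b \<in> F\<close> for every \<open>a\<close> in a generated filter,
  it suffices to treat the generators \<open>a\<close>.
\<close>

lemma rl_filter_quotient:
  assumes "rl_filter F"
  shows "rl_filter {a. sup a b \<in> F}"
proof (rule rl_filterI)
  show "1 \<in> {a. sup a b \<in> F}"
    using rl_filter_up[OF assms rl_filter_one[OF assms] sup_ge1] by simp
  show "x * y \<in> {a. sup a b \<in> F}" if "x \<in> {a. sup a b \<in> F}" "y \<in> {a. sup a b \<in> F}" for x y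
    using assms that mult_sup_le[of x b y] rl_filter_up[OF assms]
    unfolding rl_filter_def by blast
  show "y \<in> {a. sup a b \<in> F}" if "x \<in> {a. sup a b \<in> F}" "x \<le> y" for x y
    using that rl_filter_up[OF assms] sup_mono[OF \<open>x \<le> y\<close> order_refl] by blast
qed

lemma rl_filter_subset_quotient:
  assumes "rl_filter F"
  shows "F \<subseteq> {a. sup a b \<in> F}"
  using assms unfolding rl_filter_def by blast

lemma rl_filter_filter_join: "rl_filter (filter_join \<F>)"
  unfolding filter_join_def by (rule hull_in) (use rl_filter_Inter in blast)

lemma filter_join_upper:
  assumes "F \<in> \<F>"
  shows "F \<subseteq> filter_join \<F>"
  using assms hull_subset[of "\<Union>\<F>" rl_filter] unfolding filter_join_def by blast

lemma filter_join_least: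
  assumes "\<And>F. F \<in> \<F> \<Longrightarrow> F \<subseteq> G" "rl_filter G"
  shows "filter_join \<F> \<subseteq> G"
  using assms unfolding filter_join_def by (intro hull_minimal) blast+

section \<open>Prime and minimal prime filters\<close>

text \<open>
  A filter \<open>P\<close> maximal among those disjoint from \<open>S\<close> is prime. Suppose \<open>x \<squnion> y \<in> P\<close> but neither
  \<open>x\<close> nor \<open>y\<close> is in \<open>P\<close>. The quotient of \<open>P\<close> by \<open>y\<close> properly contains \<open>P\<close>, as \<open>x\<close> belongs to it,
  so it contains some \<open>s \<in> S\<close>. The quotient of \<open>P\<close> by \<open>s\<close> then properly contains \<open>P\<close>, as \<open>y\<close>
  belongs to it, so it contains some \<open>t \<in> S\<close>; now \<open>t \<squnion> s\<close> is in both \<open>P\<close> and \<open>S\<close>.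
\<close>

lemma prime_filter_separation:
  fixes S :: "'a::residuated_lattice set"
  assumes "S \<noteq> {}" "1 \<notin> S" and sup_closed: "\<And>s t. s \<in> S \<Longrightarrow> t \<in> S \<Longrightarrow> sup s t \<in> S"
    and "rl_filter F" "F \<inter> S = {}"
  obtains P where "prime_filter P" "F \<subseteq> P" "P \<inter> S = {}"
proof -
  define \<A> where "\<A> = {G. rl_filter G \<and> F \<subseteq> G \<and> G \<inter> S = {}}"
  have "\<exists>P\<in>\<A>. \<forall>G\<in>\<A>. P \<subseteq> G \<longrightarrow> G = P"
  proof (rule subset_Zorn_nonempty)
    show "\<A> \<noteq> {}"
      using assms unfolding \<A>_def by blast
    fix \<C> assume \<C>: "\<C> \<noteq> {}" "subset.chain \<A> \<C>"
    then have "subset.chain {F. rl_filter F} \<C>"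
      unfolding subset_chain_def \<A>_def by blast
    then have "rl_filter (\<Union>\<C>)"
      using rl_filter_Union_chain \<C>(1) by blast
    then show "\<Union>\<C> \<in> \<A>"
      using \<C> unfolding \<A>_def subset_chain_def by blast
  qed
  then obtain P where "P \<in> \<A>" and maximal: "\<And>G. G \<in> \<A> \<Longrightarrow> P \<subseteq> G \<Longrightarrow> G = P"
    by blast
  then have P: "rl_filter P" "F \<subseteq> P" "P \<inter> S = {}"
    unfolding \<A>_def by simp_all
  have quotient_meets: "\<exists>s\<in>S. sup s b \<in> P" if "sup a b \<in> P" "a \<notin> P" for a b
  proof (rule ccontr)
    let ?Q = "{c. sup c b \<in> P}"
    assume "\<not> ?thesis"
    moreover have "P \<subseteq> ?Q"
      using rl_filter_subset_quotient[OF P(1)] .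
    ultimately have "?Q \<in> \<A>"
      using P(2) rl_filter_quotient[OF P(1)] unfolding \<A>_def by blast
    then show False
      using maximal \<open>P \<subseteq> ?Q\<close> that by blast
  qed
  have "x \<in> P \<or> y \<in> P" if xy: "sup x y \<in> P" for x y
  proof (rule ccontr)
    assume omit: "\<not> ?thesis"
    with xy obtain s where "s \<in> S" "sup y s \<in> P"
      using quotient_meets by (metis sup_commute)
    moreover from this obtain t where "t \<in> S" "sup t s \<in> P"
      using quotient_meets omit by blast
    ultimately show False
      using sup_closed P(3) by blast
  qed
  then have "prime_filter P"
    using P assms(1) unfolding prime_filter_def by blast
  with P that show thesis by blast
qed

lemma prime_filter_above:
  fixes F :: "'a::residuated_lattice set"
  assumes "rl_filter F" "F \<noteq> UNIV"
  obtains P where "prime_filter P" "F \<subseteq> P"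
proof (rule prime_filter_separation[of "{bot}" F])
  show "1 \<notin> {bot :: 'a}" "F \<inter> {bot} = {}"
    using assms rl_filter_eq_UNIV_iff rl_filter_one by fastforce+
qed (use assms that in auto)

text \<open>
  Adjoining \<open>x\<close> to the complement of \<open>P\<close> gives the join-closed set of all \<open>s\<close> and \<open>s \<squnion> x\<close> with
  \<open>s \<notin> P\<close>, and the hypothesis says precisely that it avoids \<open>1\<close>.
\<close>

lemma prime_filter_below_omitting:
  fixes P :: "'a::residuated_lattice set"
  assumes P: "prime_filter P" and "coannihilator x \<subseteq> P"
  obtains Q where "prime_filter Q" "Q \<subseteq> P" "x \<notin> Q"
proof -
  define S where "S = - P \<union> sup x ` (- P)"
  have fil: "rl_filter P" and prime: "\<And>a b. sup a b \<in> P \<Longrightarrow> a \<in> P \<or> b \<in> P"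
    and "bot \<notin> P"
    using P rl_filter_eq_UNIV_iff unfolding prime_filter_def by blast+
  have S_iff: "s \<in> S \<longleftrightarrow> (\<exists>a. a \<notin> P \<and> (s = a \<or> s = sup x a))" for s
    unfolding S_def by blast
  have sup_closed: "sup s t \<in> S" if st: "s \<in> S" "t \<in> S" for s t
  proof -
    obtain a b where ab: "a \<notin> P" "s = a \<or> s = sup x a" "b \<notin> P" "t = b \<or> t = sup x b"
      using st S_iff by metis
    have "sup s t = sup a b \<or> sup s t = sup x (sup a b)"
      using ab(2,4) by (auto simp: ac_simps)
    then show ?thesis
      using prime ab(1,3) S_iff by blast
  qed
  have "1 \<notin> S"
    using assms(2) rl_filter_one[OF fil] unfolding S_def coannihilator_def by force
  have "S \<noteq> {}" "x \<in> S"
    using \<open>bot \<notin> P\<close> image_eqI[of x "sup x" bot "- P"] unfolding S_def by auto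
  obtain Q where "prime_filter Q" "Q \<inter> S = {}"
  proof (rule prime_filter_separation[of S "{1}"])
    show "{1} \<inter> S = {}"
      using \<open>1 \<notin> S\<close> by simp
  qed (use \<open>S \<noteq> {}\<close> \<open>1 \<notin> S\<close> sup_closed rl_filter_singleton_one in auto)
  then show thesis
    using that \<open>x \<in> S\<close> unfolding S_def by blast
qed

lemma prime_filter_Inter_chain:
  assumes "\<C> \<noteq> {}" "\<And>P. P \<in> \<C> \<Longrightarrow> prime_filter P"
    and chain: "\<And>P Q. P \<in> \<C> \<Longrightarrow> Q \<in> \<C> \<Longrightarrow> P \<subseteq> Q \<or> Q \<subseteq> P"
  shows "prime_filter (\<Inter>\<C>)"
  unfolding prime_filter_def
proof (intro conjI allI impI)
  show "rl_filter (\<Inter>\<C>)"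
    using assms(2) rl_filter_Inter unfolding prime_filter_def by blast
  show "\<Inter>\<C> \<noteq> UNIV"
    using assms(1,2) unfolding prime_filter_def by blast
  show "x \<in> \<Inter>\<C> \<or> y \<in> \<Inter>\<C>" if xy: "sup x y \<in> \<Inter>\<C>" for x y
  proof (rule ccontr)
    assume "\<not> ?thesis"
    then obtain P Q where PQ: "P \<in> \<C>" "x \<notin> P" "Q \<in> \<C>" "y \<notin> Q" by blast
    \<comment> \<open>the smaller of the two primes omits both \<open>x\<close> and \<open>y\<close>\<close>
    then obtain R where "R \<in> \<C>" "x \<notin> R" "y \<notin> R"
      using chain by blast
    then show False
      using xy assms(2) unfolding prime_filter_def by blast
  qed
qed

lemma minimal_prime_filter_below:
  fixes P :: "'a::residuated_lattice set"
  assumes "prime_filter P"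
  obtains M where "minimal_prime_filter M" "M \<subseteq> P"
proof -
  \<comment> \<open>Zorn's lemma for maximal elements, applied to complements\<close>
  define \<A> where "\<A> = {X. prime_filter (- X) \<and> - X \<subseteq> P}"
  have "\<exists>X\<in>\<A>. \<forall>Y\<in>\<A>. X \<subseteq> Y \<longrightarrow> Y = X"
  proof (rule subset_Zorn_nonempty)
    show "\<A> \<noteq> {}"
      using assms unfolding \<A>_def by (auto intro: exI[of _ "- P"])
    fix \<C> assume \<C>: "\<C> \<noteq> {}" "subset.chain \<A> \<C>"
    have "prime_filter (\<Inter>(uminus ` \<C>))"
      by (rule prime_filter_Inter_chain) (use \<C> in \<open>unfold subset_chain_def \<A>_def, blast+\<close>)
    then have "prime_filter (- \<Union>\<C>)"
      by (simp add: uminus_Sup)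
    then show "\<Union>\<C> \<in> \<A>"
      using \<C> unfolding \<A>_def subset_chain_def by blast
  qed
  then obtain X where X: "X \<in> \<A>" "\<And>Y. Y \<in> \<A> \<Longrightarrow> X \<subseteq> Y \<Longrightarrow> Y = X"
    by blast
  have "Q = - X" if "prime_filter Q" "Q \<subseteq> - X" for Q
    using X(1) X(2)[of "- Q"] that unfolding \<A>_def by auto
  then have "minimal_prime_filter (- X)"
    using X(1) unfolding minimal_prime_filter_def \<A>_def by blast
  then show thesis
    using that X(1) unfolding \<A>_def by blast
qed

lemma minimal_prime_filter_join_complement:
  assumes "minimal_prime_filter M" "x \<in> M"
  obtains y where "y \<notin> M" "sup x y = 1"
proof -
  have M: "prime_filter M" and minimal: "\<And>Q. prime_filter Q \<Longrightarrow> Q \<subseteq> M \<Longrightarrow> Q = M"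
    using assms(1) unfolding minimal_prime_filter_def by blast+
  have "\<not> coannihilator x \<subseteq> M"
  proof
    assume "coannihilator x \<subseteq> M"
    then obtain Q where "prime_filter Q" "Q \<subseteq> M" "x \<notin> Q"
      using prime_filter_below_omitting[OF M] by blast
    then show False
      using minimal assms(2) by blast
  qed
  then show thesis
    using that unfolding coannihilator_def by blast
qed

text \<open>
  The quantifiers range over elements, not over ideals or primes, so this is the form in which
  normality and the assertions on \<open>\<omega>\<close>-filters can be compared.
\<close>

definition coannihilators_comaximal :: "'a::residuated_lattice itself \<Rightarrow> bool" where
  "coannihilators_comaximal _ \<longleftrightarrow>
    (\<forall>x y :: 'a. sup x y = 1 \<longrightarrow> filter_join {coannihilator x, coannihilator y} = UNIV)"

text \<open>
  A coannihilator \<open>x\<^sup>\<bottom>\<close> lies in every prime filter omitting \<open>x\<close>. Given distinct minimal primes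
  \<open>M\<close> and \<open>N\<close>, some \<open>x \<in> M\<close> is omitted by \<open>N\<close>, and a join-complement \<open>y\<close> of it is omitted by \<open>M\<close>.
\<close>

theorem normal_iff_coannihilators_comaximal:
  "normal_rl TYPE('a::residuated_lattice) \<longleftrightarrow> coannihilators_comaximal TYPE('a)"
proof
  assume normal: "normal_rl TYPE('a)"
  show "coannihilators_comaximal TYPE('a)"
    unfolding coannihilators_comaximal_def
  proof (intro allI impI, rule ccontr)
    fix x y :: 'a
    assume xy: "sup x y = 1" and "filter_join {coannihilator x, coannihilator y} \<noteq> UNIV"
    then obtain P where P: "prime_filter P" "filter_join {coannihilator x, coannihilator y} \<subseteq> P"
      using prime_filter_above[OF rl_filter_filter_join] by blast
    then have above: "coannihilator x \<subseteq> P" "coannihilator y \<subseteq> P"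
      using filter_join_upper[of _ "{coannihilator x, coannihilator y}"] by blast+
    have omit: "\<exists>M. minimal_prime_filter M \<and> M \<subseteq> P \<and> z \<notin> M" if "coannihilator z \<subseteq> P" for z
    proof -
      obtain Q where "prime_filter Q" "Q \<subseteq> P" "z \<notin> Q"
        using prime_filter_below_omitting[OF P(1) \<open>coannihilator z \<subseteq> P\<close>] by blast
      moreover from this obtain M where "minimal_prime_filter M" "M \<subseteq> Q"
        using minimal_prime_filter_below[of Q] by blast
      ultimately show ?thesis by blast
    qed
    obtain M where M: "minimal_prime_filter M" "M \<subseteq> P" "x \<notin> M"
      using omit[OF above(1)] by blast
    obtain N where N: "minimal_prime_filter N" "N \<subseteq> P" "y \<notin> N"
      using omit[OF above(2)] by blast
    have "M = N"
      using normal P(1) M(1,2) N(1,2) unfolding normal_rl_def by blast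
    moreover have "sup x y \<in> M"
      using xy M(1) rl_filter_one[of M] unfolding minimal_prime_filter_def prime_filter_def by simp
    ultimately show False
      using M N(3) unfolding minimal_prime_filter_def prime_filter_def by blast
  qed
next
  assume comax: "coannihilators_comaximal TYPE('a)"
  have coann: "coannihilator x \<subseteq> Q" if "prime_filter Q" "x \<notin> Q" for x :: 'a and Q
  proof
    fix a assume "a \<in> coannihilator x"
    then have "sup x a \<in> Q"
      using that(1) rl_filter_one[of Q] unfolding coannihilator_def prime_filter_def by simp
    then show "a \<in> Q"
      using that unfolding prime_filter_def by blast
  qed
  show "normal_rl TYPE('a)"
    unfolding normal_rl_def
  proof (intro allI impI, elim conjE, rule ccontr)
    fix P M N :: "'a set"
    assume P: "prime_filter P" "M \<subseteq> P" "N \<subseteq> P"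
      and MN: "minimal_prime_filter M" "minimal_prime_filter N" "M \<noteq> N"
    then obtain x where x: "x \<in> M" "x \<notin> N"
      unfolding minimal_prime_filter_def by blast
    then obtain y where y: "y \<notin> M" "sup x y = 1"
      using minimal_prime_filter_join_complement[OF MN(1)] by blast
    have "coannihilator x \<subseteq> P" "coannihilator y \<subseteq> P"
      using coann x y P MN unfolding minimal_prime_filter_def by blast+
    then have "filter_join {coannihilator x, coannihilator y} \<subseteq> P"
      using P(1) unfolding prime_filter_def by (intro filter_join_least) blast+
    then show False
      using comax y(2) P(1) unfolding coannihilators_comaximal_def prime_filter_def by blast
  qed
qed

section \<open>Coannihilators and omega-filters\<close>

lemma rl_filter_omega:
  assumes "lattice_ideal I"
  shows "rl_filter (omega I)"
proof (rule rl_filterI)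
  show "1 \<in> omega I"
    using assms unfolding omega_def lattice_ideal_def by (auto simp: one_eq_top)
  show "a * b \<in> omega I" if "a \<in> omega I" "b \<in> omega I" for a b
  proof -
    obtain i j where ij: "i \<in> I" "j \<in> I" "sup i a = 1" "sup j b = 1"
      using \<open>a \<in> omega I\<close> \<open>b \<in> omega I\<close> unfolding omega_def by blast
    have "sup a (sup i j) = 1" "sup b (sup i j) = 1"
      using ij(3,4) sup_eq_one_mono[of _ _ "sup i j"] by (metis sup_commute sup_ge1 sup_ge2)+
    then have "sup (sup i j) (a * b) = 1"
      using mult_sup_eq_one by (metis sup_commute)
    moreover have "sup i j \<in> I"
      using assms ij(1,2) unfolding lattice_ideal_def by blast
    ultimately show ?thesis
      unfolding omega_def by blast
  qed
  show "b \<in> omega I" if "a \<in> omega I" "a \<le> b" for a b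
    using that sup_eq_one_mono[of a _ b] unfolding omega_def by (auto simp: sup_commute)
qed

lemma omega_in_omega_filters:
  assumes "lattice_ideal I"
  shows "omega I \<in> omega_filters"
  using assms rl_filter_omega unfolding omega_filters_def by blast

lemma omega_filtersE:
  assumes "F \<in> omega_filters"
  obtains I where "lattice_ideal I" "F = omega I"
  using assms unfolding omega_filters_def by blast

lemma omega_eq_Union_coannihilator: "omega X = (\<Union>x\<in>X. coannihilator x)"
  unfolding omega_def coannihilator_def by blast

lemma coannihilator_antimono:
  fixes x y :: "'a::residuated_lattice"
  assumes "x \<le> y"
  shows "coannihilator x \<subseteq> coannihilator y"
  using assms sup_eq_one_mono unfolding coannihilator_def by blast

lemma lattice_ideal_atMost: "lattice_ideal {..x :: 'a::lattice}"
  unfolding lattice_ideal_def by (auto intro: order_trans)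

lemma coannihilator_eq_omega:
  fixes x :: "'a::residuated_lattice"
  shows "coannihilator x = omega {..x}"
  unfolding omega_eq_Union_coannihilator using coannihilator_antimono by blast

lemma coannihilator_in_omega_filters:
  fixes x :: "'a::residuated_lattice"
  shows "coannihilator x \<in> omega_filters"
  by (simp add: coannihilator_eq_omega lattice_ideal_atMost omega_in_omega_filters)

lemma coannihilator_Int:
  fixes x y :: "'a::residuated_lattice"
  shows "coannihilator x \<inter> coannihilator y = coannihilator (x * y)"
proof
  show "coannihilator x \<inter> coannihilator y \<subseteq> coannihilator (x * y)"
    unfolding coannihilator_def by (simp add: mult_sup_eq_one subset_iff)
  show "coannihilator (x * y) \<subseteq> coannihilator x \<inter> coannihilator y"
    by (simp add: coannihilator_antimono mult_le_left mult_le_right)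
qed

lemma omega_Int:
  assumes "lattice_ideal I" "lattice_ideal J"
  shows "omega I \<inter> omega J = omega (I \<inter> J)"
proof
  show "omega I \<inter> omega J \<subseteq> omega (I \<inter> J)"
  proof
    fix a assume "a \<in> omega I \<inter> omega J"
    then obtain i j where ij: "i \<in> I" "sup i a = 1" "j \<in> J" "sup j a = 1"
      unfolding omega_def by blast
    then have "i * j \<in> I \<inter> J"
      using assms mult_le_left[of i j] mult_le_right[of i j] unfolding lattice_ideal_def by blast
    moreover have "sup (i * j) a = 1"
      using ij(2,4) by (rule mult_sup_eq_one)
    ultimately show "a \<in> omega (I \<inter> J)"
      unfolding omega_def by blast
  qed
qed (auto simp: omega_def)

lemma lattice_ideal_bot:
  fixes I :: "'a::bounded_lattice set"
  assumes "lattice_ideal I"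
  shows "bot \<in> I"
  using assms bot_least unfolding lattice_ideal_def by blast

lemma lattice_ideal_Int:
  fixes I J :: "'a::bounded_lattice set"
  assumes "lattice_ideal I" "lattice_ideal J"
  shows "lattice_ideal (I \<inter> J)"
proof -
  have "I \<inter> J \<noteq> {}"
    using assms[THEN lattice_ideal_bot] by blast
  then show ?thesis
    using assms unfolding lattice_ideal_def by auto
qed

lemma omega_filters_Int:
  assumes "F \<in> omega_filters" "G \<in> omega_filters"
  shows "F \<inter> G \<in> omega_filters"
  using assms by (metis omega_filtersE omega_Int lattice_ideal_Int omega_in_omega_filters)

text \<open>
  Let \<open>H = \<omega>(I)\<close>. Since \<open>y \<in> x\<^sup>\<bottom> \<subseteq> H\<close>, the element \<open>y\<close> has a join-complement \<open>z \<in> I\<close>. Then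
  \<open>z \<in> y\<^sup>\<bottom> \<subseteq> H\<close>, so \<open>z\<close> has a join-complement \<open>w \<in> I\<close> as well, and \<open>1 = w \<squnion> z \<in> I\<close>.
\<close>

lemma omega_filter_above_comaximal_pair:
  fixes x y :: "'a::residuated_lattice"
  assumes "sup x y = 1" "H \<in> omega_filters" "coannihilator x \<subseteq> H" "coannihilator y \<subseteq> H"
  shows "H = UNIV"
proof -
  obtain I where I: "lattice_ideal I" "H = omega I"
    using assms(2) omega_filtersE by blast
  have "y \<in> H"
    using assms(1,3) unfolding coannihilator_def by blast
  then obtain z where z: "z \<in> I" "sup z y = 1"
    using I(2) unfolding omega_def by blast
  then have "z \<in> H"
    using assms(4) unfolding coannihilator_def by (auto simp: sup_commute)
  then obtain w where "w \<in> I" "sup w z = 1"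
    using I(2) unfolding omega_def by blast
  then have "1 \<in> I"
    using I(1) z(1) unfolding lattice_ideal_def by metis
  moreover have "sup 1 a = 1" for a :: 'a
    by (simp add: sup.absorb1)
  ultimately show ?thesis
    using I(2) unfolding omega_def by blast
qed

lemma comaximal_if_joins_omega_filters:
  assumes "\<And>x y :: 'a::residuated_lattice.
    filter_join {coannihilator x, coannihilator y} \<in> omega_filters"
  shows "coannihilators_comaximal TYPE('a)"
  unfolding coannihilators_comaximal_def
proof (intro allI impI)
  fix x y :: 'a assume "sup x y = 1"
  then show "filter_join {coannihilator x, coannihilator y} = UNIV"
    by (rule omega_filter_above_comaximal_pair[OF _ assms]) (simp_all add: filter_join_upper)
qed

text \<open>
  Let \<open>K\<close> be the join of \<open>x\<^sup>\<bottom>\<close> and \<open>y\<^sup>\<bottom>\<close>, and let \<open>a \<in> (x \<squnion> y)\<^sup>\<bottom>\<close>. Since \<open>x \<squnion> (y \<squnion> a) = 1\<close>,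
  comaximality applies to \<open>x\<close> and \<open>y \<squnion> a\<close>. The quotient of \<open>K\<close> by \<open>a\<close> contains both \<open>x\<^sup>\<bottom>\<close> and
  \<open>(y \<squnion> a)\<^sup>\<bottom>\<close>, so it contains the least element, which means \<open>a \<in> K\<close>.
\<close>

lemma filter_join_coannihilators:
  fixes x y :: "'a::residuated_lattice"
  assumes "coannihilators_comaximal TYPE('a)"
  shows "filter_join {coannihilator x, coannihilator y} = coannihilator (sup x y)"
    (is "?K = _")
proof
  show "?K \<subseteq> coannihilator (sup x y)"
    using coannihilator_antimono[of x "sup x y"] coannihilator_antimono[of y "sup x y"]
      coannihilator_in_omega_filters[of "sup x y"]
    by (intro filter_join_least) (auto simp: omega_filters_def)
  show "coannihilator (sup x y) \<subseteq> ?K"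
  proof
    fix a assume "a \<in> coannihilator (sup x y)"
    then have "sup x (sup y a) = 1"
      unfolding coannihilator_def by (simp add: ac_simps)
    then have "filter_join {coannihilator x, coannihilator (sup y a)} = UNIV"
      using assms unfolding coannihilators_comaximal_def by blast
    moreover have "coannihilator x \<subseteq> {c. sup c a \<in> ?K}"
      using filter_join_upper[of "coannihilator x"]
        rl_filter_subset_quotient[OF rl_filter_filter_join] by blast
    moreover have "coannihilator (sup y a) \<subseteq> {c. sup c a \<in> ?K}"
    proof
      fix c assume "c \<in> coannihilator (sup y a)"
      then have "sup c a \<in> coannihilator y"
        unfolding coannihilator_def by (simp add: ac_simps)
      then show "c \<in> {c. sup c a \<in> ?K}"
        using filter_join_upper[of "coannihilator y"] by blast
    qed
    ultimately have "bot \<in> {c. sup c a \<in> ?K}"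
      using filter_join_least[of "{coannihilator x, coannihilator (sup y a)}" "{c. sup c a \<in> ?K}"]
        rl_filter_quotient[OF rl_filter_filter_join] by blast
    then show "a \<in> ?K" by simp
  qed
qed

lemma omega_filters_filter_join:
  fixes \<F> :: "'a::residuated_lattice set set"
  assumes "coannihilators_comaximal TYPE('a)" "\<F> \<subseteq> omega_filters"
  shows "filter_join \<F> \<in> omega_filters"
proof -
  define K where "K = filter_join \<F>"
  \<comment> \<open>the largest ideal whose \<open>\<omega>\<close>-filter is contained in \<open>K\<close>\<close>
  define I where "I = {x. coannihilator x \<subseteq> K}"
  have K: "rl_filter K"
    unfolding K_def by (rule rl_filter_filter_join)
  have "coannihilator (bot :: 'a) \<subseteq> K"
    using rl_filter_one[OF K] unfolding coannihilator_def by simp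
  moreover have "coannihilator (sup x y) \<subseteq> K"
    if "coannihilator x \<subseteq> K" "coannihilator y \<subseteq> K" for x y
    using that K filter_join_least[of "{coannihilator x, coannihilator y}" K]
    by (auto simp: filter_join_coannihilators[OF assms(1)])
  ultimately have I: "lattice_ideal I"
    unfolding lattice_ideal_def I_def using coannihilator_antimono by blast
  have "omega I = K"
  proof
    show "omega I \<subseteq> K"
      unfolding omega_eq_Union_coannihilator I_def by blast
    show "K \<subseteq> omega I"
      unfolding K_def
    proof (rule filter_join_least)
      fix F assume "F \<in> \<F>"
      moreover from this obtain J where "F = omega J"
        using assms(2) omega_filtersE by blast
      ultimately show "F \<subseteq> omega I"
        using filter_join_upper[of F \<F>]
        unfolding omega_eq_Union_coannihilator I_def K_def by blast
    qed (rule rl_filter_omega[OF I])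
  qed
  then show ?thesis
    using omega_in_omega_filters[OF I] unfolding K_def by simp
qed

section \<open>The equivalent assertions\<close>

text \<open>
  For \<open>F = \<omega>(I)\<close> and \<open>G = \<omega>(J)\<close>, the \<open>\<omega>\<close>-join contains the least element exactly when
  \<open>i \<squnion> j = 1\<close> for some \<open>i \<in> I\<close> and \<open>j \<in> J\<close>, and then \<open>F\<close> and \<open>G\<close> contain the coannihilators of
  these two elements.
\<close>

lemma omega_join_eq_UNIV_iff:
  fixes I J :: "'a::residuated_lattice set"
  assumes "lattice_ideal I" "lattice_ideal J"
  shows "omega_join (omega I) (omega J) = UNIV \<longleftrightarrow> (\<exists>i\<in>I. \<exists>j\<in>J. sup i j = 1)"
proof -
  let ?K = "{a. \<exists>i\<in>I. \<exists>j\<in>J. sup (sup i j) a = 1}"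
  have "?K = UNIV \<longleftrightarrow> (\<exists>i\<in>I. \<exists>j\<in>J. sup i j = 1)"
  proof
    assume "?K = UNIV"
    then have "bot \<in> ?K" by simp
    then show "\<exists>i\<in>I. \<exists>j\<in>J. sup i j = 1" by simp
  next
    assume "\<exists>i\<in>I. \<exists>j\<in>J. sup i j = 1"
    then obtain i j where "i \<in> I" "j \<in> J" "sup i j = 1" by blast
    moreover from this have "sup (sup i j) a = 1" for a
      by (simp add: one_eq_top)
    ultimately show "?K = UNIV" by blast
  qed
  then show ?thesis
    by (simp add: omega_join_omega[OF assms] omega_ideal_join[OF assms])
qed

lemma omega_join_condition_iff_comaximal:
  "(\<forall>F\<in>omega_filters. \<forall>G\<in>omega_filters :: 'a::residuated_lattice set set.
      omega_join F G = UNIV \<longrightarrow> filter_join {F, G} = UNIV)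
    \<longleftrightarrow> coannihilators_comaximal TYPE('a)"
proof
  assume joins: "\<forall>F\<in>omega_filters. \<forall>G\<in>omega_filters :: 'a set set.
      omega_join F G = UNIV \<longrightarrow> filter_join {F, G} = UNIV"
  show "coannihilators_comaximal TYPE('a)"
    unfolding coannihilators_comaximal_def
  proof (intro allI impI)
    fix x y :: 'a assume "sup x y = 1"
    then have "omega_join (coannihilator x) (coannihilator y) = UNIV"
      unfolding coannihilator_eq_omega
      using omega_join_eq_UNIV_iff[OF lattice_ideal_atMost lattice_ideal_atMost] by blast
    then show "filter_join {coannihilator x, coannihilator y} = UNIV"
      using joins coannihilator_in_omega_filters by blast
  qed
next
  assume comax: "coannihilators_comaximal TYPE('a)"
  show "\<forall>F\<in>omega_filters. \<forall>G\<in>omega_filters :: 'a set set.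
      omega_join F G = UNIV \<longrightarrow> filter_join {F, G} = UNIV"
  proof (intro ballI impI)
    fix F G :: "'a set"
    assume "F \<in> omega_filters" "G \<in> omega_filters" and join: "omega_join F G = UNIV"
    then obtain I J where IJ: "lattice_ideal I" "F = omega I" "lattice_ideal J" "G = omega J"
      using omega_filtersE by metis
    then obtain i j where ij: "i \<in> I" "j \<in> J" "sup i j = 1"
      using join omega_join_eq_UNIV_iff by blast
    have "coannihilator i \<subseteq> filter_join {F, G}" "coannihilator j \<subseteq> filter_join {F, G}"
      using IJ ij filter_join_upper[of _ "{F, G}"]
      unfolding omega_eq_Union_coannihilator by blast+
    then have "filter_join {coannihilator i, coannihilator j} \<subseteq> filter_join {F, G}"
      by (intro filter_join_least) (auto simp: rl_filter_filter_join)
    then show "filter_join {F, G} = UNIV"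
      using comax ij(3) unfolding coannihilators_comaximal_def by blast
  qed
qed

theorem proposition4p7:
  shows "((\<forall>F\<in>omega_filters. \<forall>G\<in>omega_filters :: 'a::residuated_lattice set set.
            omega_join F G = UNIV \<longrightarrow> filter_join {F, G} = UNIV)
          \<longleftrightarrow> normal_rl TYPE('a))
       \<and> ((\<forall>\<F> \<subseteq> (omega_filters :: 'a set set). filter_join \<F> \<in> omega_filters)
          \<longleftrightarrow> normal_rl TYPE('a))
       \<and> (filter_sublattice (omega_filters :: 'a set set) \<longleftrightarrow> normal_rl TYPE('a))
       \<and> (filter_sublattice (coannihilators :: 'a set set) \<longleftrightarrow> normal_rl TYPE('a))"
proof -
  let ?comax = "coannihilators_comaximal TYPE('a)"
  have omega_joins: "filter_join \<F> \<in> omega_filters"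
    if ?comax "\<F> \<subseteq> omega_filters" for \<F> :: "'a set set"
    using that by (rule omega_filters_filter_join)
  have coann: "coannihilator x \<in> omega_filters" for x :: 'a
    by (rule coannihilator_in_omega_filters)
  have "(\<forall>\<F> \<subseteq> (omega_filters :: 'a set set). filter_join \<F> \<in> omega_filters) \<longleftrightarrow> ?comax"
  proof
    assume "\<forall>\<F> \<subseteq> (omega_filters :: 'a set set). filter_join \<F> \<in> omega_filters"
    then show ?comax
      using coann by (intro comaximal_if_joins_omega_filters) simp
  qed (use omega_joins in blast)
  moreover have "filter_sublattice (omega_filters :: 'a set set) \<longleftrightarrow> ?comax"
  proof
    assume "filter_sublattice (omega_filters :: 'a set set)"
    then show ?comax
      using coann unfolding filter_sublattice_def
      by (intro comaximal_if_joins_omega_filters) simp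
  next
    assume ?comax
    then show "filter_sublattice (omega_filters :: 'a set set)"
      unfolding filter_sublattice_def
      by (auto simp: omega_joins omega_filters_Int) (simp add: omega_filters_def)
  qed
  moreover have "filter_sublattice (coannihilators :: 'a set set) \<longleftrightarrow> ?comax"
  proof
    assume "filter_sublattice (coannihilators :: 'a set set)"
    then have "filter_join {coannihilator x, coannihilator y} \<in> coannihilators" for x y :: 'a
      unfolding filter_sublattice_def coannihilators_def by simp
    then show ?comax
      using coann unfolding coannihilators_def
      by (intro comaximal_if_joins_omega_filters) (metis rangeE)
  next
    assume ?comax
    moreover have "rl_filter (coannihilator x)" for x :: 'a
      using coann[of x] unfolding omega_filters_def by simp
    ultimately show "filter_sublattice (coannihilators :: 'a set set)"
      unfolding filter_sublattice_def coannihilators_def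
      by (auto simp: filter_join_coannihilators coannihilator_Int)
  qed
  ultimately show ?thesis
    by (simp only: normal_iff_coannihilators_comaximal omega_join_condition_iff_comaximal
        simp_thms)
qed

end
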